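(* Let $n>3$. Then the verbal subgroup $V_{S(A_n)}(A_n)$ generated by the squares of elements of $A_n$ equals $A_n$, and its verbal width is $2$; that is, the least $m$ such that every element of $A_n$ is a product of at most $m$ squares of elements of $A_n$ is $m=2$.
   Context: For a group $G$, $S(G)=\{x^2 : x\in G\}$ is the set of all squares of elements of $G$, and $V_{S(G)}(G)$ is the subgroup of $G$ generated by $S(G)$. The verbal width of $V_{S(G)}(G)$ is the least $m\in\mathbb N\cup\{\infty\}$ such that every element of $V_{S(G)}(G)$ is a product of at most $m$ elements of $S(G)$. *)

theory Defs
  imports "HOL-Algebra.Sym_Groups" "HOL-Library.Extended_Nat"
begin

definition group_squares :: "('a, 'b) monoid_scheme \<Rightarrow> 'a set" where
  "group_squares G = {x [^]\<^bsub>G\<^esub> (2::nat) | x. x \<in> carrier G}"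

definition verbal_subgroup :: "('a, 'b) monoid_scheme \<Rightarrow> 'a set \<Rightarrow> 'a set" where
  "verbal_subgroup G S = generate G S"

definition product_of_at_most ::
    "('a, 'b) monoid_scheme \<Rightarrow> 'a set \<Rightarrow> enat \<Rightarrow> 'a \<Rightarrow> bool" where
  "product_of_at_most G S m g \<longleftrightarrow>
     (\<exists>xs. set xs \<subseteq> S \<and> enat (length xs) \<le> m \<and> foldr (\<otimes>\<^bsub>G\<^esub>) xs \<one>\<^bsub>G\<^esub> = g)"

text \<open>
  On \<^typ>\<open>enat\<close>, the infimum of a nonempty set is its least element. For \<open>S\<close> closed under
  inverses, such as the set of squares of a group, the set below contains \<open>\<infinity>\<close>, since the
  factors then need no inverses. The empty word counts as a product of \<open>0\<close> factors.
\<close>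

definition verbal_width :: "('a, 'b) monoid_scheme \<Rightarrow> 'a set \<Rightarrow> enat" where
  "verbal_width G S = Inf {m. \<forall>g \<in> verbal_subgroup G S. product_of_at_most G S m g}"

end

theory Submission
  imports Defs
begin

text \<open>
  Upper bound.  If \<open>f\<close> has odd order \<open>2k + 1\<close>, then \<open>f\<close> is the square of \<open>f\<^sup>k\<^sup>+\<^sup>1\<close>; being a
  square, \<open>f\<close> is even, and so is its power \<open>f\<^sup>k\<^sup>+\<^sup>1\<close>.  So it suffices to write each even
  permutation as a product of two permutations of odd order.  Cycles of odd length have odd
  order.  An even permutation has an even number of cycles of even length, so these can be taken
  in pairs, and two disjoint cycles of even length satisfy
  \<open>(a b x\<^sub>1 \<dots> x\<^sub>r)(c d y\<^sub>1 \<dots> y\<^sub>s) = (a b c)(b x\<^sub>1 \<dots> x\<^sub>r c d y\<^sub>1 \<dots> y\<^sub>s)\<close>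
  (lemma \<open>cycle_comp_cycle\<close>), a product of a 3-cycle and a cycle of odd length \<open>r + s + 3\<close>.
  Permutations with disjoint supports commute, so the left factors of all pairs together have odd
  order, and so do the right factors together with the cycles of odd length.

  Lower bound.  Squaring sends both the identity and \<open>(1 2)(3 4)\<close> to the identity.  A self-map
  of the finite set \<open>A\<^sub>n\<close> that is not injective is not surjective, so some element of \<open>A\<^sub>n\<close> is not
  a square.
\<close>

section \<open>Permutations of odd order\<close>

definition odd_order :: "('a \<Rightarrow> 'a) \<Rightarrow> bool" where
  "odd_order f \<longleftrightarrow> (\<exists>m. odd m \<and> f ^^ m = id)"

definition odd_order_product :: "'a set \<Rightarrow> ('a \<Rightarrow> 'a) \<Rightarrow> bool" where
  "odd_order_product S p \<longleftrightarrow>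
     (\<exists>f g. f permutes S \<and> g permutes S \<and> odd_order f \<and> odd_order g \<and> p = f \<circ> g)"

lemma odd_order_id: "odd_order id"
  unfolding odd_order_def by (rule exI[of _ 1]) simp

lemma odd_order_cycle:
  assumes "distinct cs" and "odd (length cs)"
  shows "odd_order (cycle_of_list cs)"
  using assms cycle_is_id_root unfolding odd_order_def by blast

lemma permutes_disjoint_commute:
  assumes f: "f permutes S" and g: "g permutes T" and disj: "S \<inter> T = {}"
  shows "f \<circ> g = g \<circ> f"
proof
  fix x
  consider "x \<in> S" | "x \<in> T" | "x \<notin> S" "x \<notin> T" by blast
  then show "(f \<circ> g) x = (g \<circ> f) x"
  proof cases
    case 1
    then have "x \<notin> T" "f x \<notin> T"
      using disj permutes_in_image[OF f] by blast+
    then show ?thesis using permutes_not_in[OF g] by simp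
  next
    case 2
    then have "x \<notin> S" "g x \<notin> S"
      using disj permutes_in_image[OF g] by blast+
    then show ?thesis using permutes_not_in[OF f] by simp
  next
    case 3
    then show ?thesis using permutes_not_in[OF f] permutes_not_in[OF g] by simp
  qed
qed

lemma funpow_comp_of_commute:
  assumes "f \<circ> g = g \<circ> f"
  shows "(f \<circ> g) ^^ n = (f ^^ n) \<circ> (g ^^ n)"
proof (induction n)
  case (Suc n)
  have "(f ^^ k) \<circ> g = g \<circ> (f ^^ k)" for k
  proof (induction k)
    case (Suc k)
    then show ?case using assms by (simp add: fun_eq_iff)
  qed simp
  then show ?case
    using Suc.IH by (simp add: fun_eq_iff)
qed simp

lemma odd_order_comp:
  assumes "odd_order f" and "odd_order g" and comm: "f \<circ> g = g \<circ> f"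
  shows "odd_order (f \<circ> g)"
proof -
  obtain m k where m: "odd m" "f ^^ m = id" and k: "odd k" "g ^^ k = id"
    using assms unfolding odd_order_def by blast
  have "f ^^ (m * k) = id"
    using m(2) by (metis funpow_mult id_funpow)
  moreover have "g ^^ (m * k) = id"
    using k(2) by (metis funpow_mult id_funpow mult.commute)
  ultimately have "(f \<circ> g) ^^ (m * k) = id"
    by (simp add: funpow_comp_of_commute[OF comm])
  then show ?thesis
    using m(1) k(1) unfolding odd_order_def by (metis even_mult_iff)
qed

text \<open>
  The square root \<open>h\<close> below is a power of \<open>f\<close>.  That \<open>h\<close> is even follows from \<open>f = h\<^sup>2\<close>: the
  square \<open>f\<close> is even, and so are all its powers.
\<close>

lemma odd_order_imp_square:
  assumes f: "f permutes {1..n}" and "odd_order f"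
  shows "f \<in> group_squares (alt_group n)"
proof -
  interpret A: group "alt_group n" by (rule alt_group_is_group)
  obtain m where "odd m" and fm: "f ^^ m = id"
    using assms unfolding odd_order_def by blast
  then obtain k where m: "m = 2 * k + 1" by (elim oddE)
  define h where "h = f ^^ (k + 1)"
  have hp: "h permutes {1..n}"
    unfolding h_def by (rule permutes_funpow[OF f])
  have "h \<circ> h = f ^^ (m + 1)"
    unfolding h_def m by (simp only: funpow_add[symmetric]) (simp add: mult_2)
  then have hh: "h \<circ> h = f" using fm by simp
  have "permutation h"
    using hp permutation_permutes by blast
  then have "evenperm f"
    using hh evenperm_comp by metis
  have "evenperm (f ^^ j)" for j
  proof (induction j)
    case (Suc j)
    moreover have "permutation f" using f permutation_permutes by blast
    ultimately show ?case
      using \<open>evenperm f\<close> evenperm_comp permutation_funpow by (metis funpow.simps(2))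
  qed simp
  then have "h \<in> carrier (alt_group n)"
    using hp unfolding alt_group_carrier h_def by blast
  moreover have "h [^]\<^bsub>alt_group n\<^esub> (2::nat) = f"
    using hh calculation by (simp add: numeral_2_eq_2 A.nat_pow_Suc alt_group_mult alt_group_one)
  ultimately show ?thesis
    unfolding group_squares_def by blast
qed

section \<open>Even permutations as products of two permutations of odd order\<close>

lemma odd_order_product_id: "odd_order_product S id"
  unfolding odd_order_product_def
  by (intro exI[of _ id] conjI) (simp_all add: odd_order_id)

lemma odd_order_product_odd_cycle:
  assumes "distinct cs" and "odd (length cs)"
  shows "odd_order_product (set cs) (cycle_of_list cs)"
  unfolding odd_order_product_def
  by (intro exI[of _ id] exI[of _ "cycle_of_list cs"] conjI)
    (simp_all add: odd_order_id odd_order_cycle[OF assms] cycle_permutes)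

lemma odd_order_product_disjoint_comp:
  assumes "odd_order_product S p" and "odd_order_product T q" and disj: "S \<inter> T = {}"
  shows "odd_order_product (S \<union> T) (p \<circ> q)"
proof -
  obtain f g where f: "f permutes S" "odd_order f" and g: "g permutes S" "odd_order g"
    and p: "p = f \<circ> g"
    using assms unfolding odd_order_product_def by blast
  obtain f' g' where f': "f' permutes T" "odd_order f'" and g': "g' permutes T" "odd_order g'"
    and q: "q = f' \<circ> g'"
    using assms unfolding odd_order_product_def by blast
  have "g \<circ> f' = f' \<circ> g"
    by (rule permutes_disjoint_commute[OF g(1) f'(1) disj])
  then have "p \<circ> q = (f \<circ> f') \<circ> (g \<circ> g')"
    unfolding p q by (metis comp_assoc)
  moreover have "odd_order (f \<circ> f')" "odd_order (g \<circ> g')"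
    using f f' g g' disj by (simp_all add: odd_order_comp permutes_disjoint_commute)
  moreover have "(f \<circ> f') permutes (S \<union> T)" "(g \<circ> g') permutes (S \<union> T)"
    using f f' g g' by (meson permutes_compose permutes_subset sup_ge1 sup_ge2)+
  ultimately show ?thesis
    unfolding odd_order_product_def by blast
qed

lemma cycle_of_list_append:
  "cycle_of_list (xs @ c # ys) = cycle_of_list (xs @ [c]) \<circ> cycle_of_list (c # ys)"
proof (induction xs rule: cycle_of_list.induct)
  case (1 i j xs)
  then show ?case by (simp add: comp_assoc)
qed (simp_all add: comp_assoc)

text \<open>
  The long cycle on the right is \<open>(b x\<^sub>1 \<dots> x\<^sub>r c)(c y\<^sub>1 \<dots> y\<^sub>s)\<close>, and its first factor is
  \<open>(c b)(b x\<^sub>1 \<dots> x\<^sub>r)\<close>.  The transposition \<open>(b c)\<close> at the right end of \<open>(a b c) = (a b)(b c)\<close>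
  cancels \<open>(c b)\<close>, which leaves \<open>(a b)(b x\<^sub>1 \<dots> x\<^sub>r) = (a b x\<^sub>1 \<dots> x\<^sub>r)\<close>.
\<close>

lemma cycle_comp_cycle:
  assumes "distinct ((a # b # xs) @ (c # ys))"
  shows "cycle_of_list (a # b # xs) \<circ> cycle_of_list (c # ys) =
         cycle_of_list [a, b, c] \<circ> cycle_of_list (b # xs @ c # ys)"
proof -
  have "cycle_of_list (c # b # xs) = cycle_of_list (rotate 1 (c # b # xs))"
    using assms by (intro cycle_of_list_rotate_independent) auto
  then have rot: "cycle_of_list (b # xs @ [c]) = transpose c b \<circ> cycle_of_list (b # xs)"
    by simp
  have "cycle_of_list (b # xs @ c # ys) =
        transpose c b \<circ> cycle_of_list (b # xs) \<circ> cycle_of_list (c # ys)"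
    using cycle_of_list_append[of "b # xs" c ys] rot by simp
  moreover have "transpose b c \<circ> (transpose c b \<circ> h) = h" for h :: "'a \<Rightarrow> 'a"
    by (simp add: fun_eq_iff transpose_commute)
  ultimately show ?thesis
    by (simp add: comp_assoc)
qed

lemma odd_order_product_two_even_cycles:
  assumes "distinct cs" "even (length cs)" "cs \<noteq> []"
    and "distinct ds" "even (length ds)" "ds \<noteq> []"
    and "set cs \<inter> set ds = {}"
  shows "odd_order_product (set cs \<union> set ds) (cycle_of_list cs \<circ> cycle_of_list ds)"
proof -
  obtain a b xs where cs: "cs = a # b # xs"
    using assms(2,3) by (metis One_nat_def even_Suc length_Cons list.exhaust list.size(3) dvd_0_right)
  obtain c ys where ds: "ds = c # ys"
    using assms(6) by (cases ds) auto
  let ?z = "b # xs @ c # ys"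
  have "cycle_of_list cs \<circ> cycle_of_list ds = cycle_of_list [a, b, c] \<circ> cycle_of_list ?z"
    using assms unfolding cs ds by (intro cycle_comp_cycle) auto
  moreover have "odd_order (cycle_of_list [a, b, c])"
    using assms unfolding cs ds by (intro odd_order_cycle) auto
  moreover have "odd_order (cycle_of_list ?z)"
    using assms unfolding cs ds by (intro odd_order_cycle) auto
  moreover have "cycle_of_list [a, b, c] permutes (set cs \<union> set ds)"
    by (rule permutes_subset[OF cycle_permutes]) (auto simp: cs ds)
  moreover have "cycle_of_list ?z permutes (set cs \<union> set ds)"
    by (rule permutes_subset[OF cycle_permutes]) (auto simp: cs ds)
  ultimately show ?thesis
    unfolding odd_order_product_def by blast
qed

text \<open>
  Adding the disjoint cycles of \<open>p\<close> one at a time leaves at most one cycle of even length waiting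
  for a partner; the second alternative records this cycle as \<open>ds\<close>.
\<close>

lemma cycle_decomp_odd_order_product:
  assumes "cycle_decomp S p"
  shows "odd_order_product S p \<or>
    (\<exists>ds T q. distinct ds \<and> even (length ds) \<and> ds \<noteq> [] \<and> set ds \<inter> T = {} \<and> S = set ds \<union> T
       \<and> odd_order_product T q \<and> p = cycle_of_list ds \<circ> q)"
  using assms
proof (induction rule: cycle_decomp.induct)
  case empty
  show ?case by (rule disjI1) (rule odd_order_product_id)
next
  case (comp I p cs)
  note cs = \<open>distinct cs\<close> \<open>set cs \<inter> I = {}\<close>
  consider "cs = []" | "odd (length cs)" | "even (length cs)" "cs \<noteq> []" by blast
  then show ?case
  proof cases
    case 1
    then show ?thesis using comp.IH by simp
  next
    case odd_cs: 2
    note oc = odd_order_product_odd_cycle[OF cs(1) odd_cs]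
    from comp.IH show ?thesis
    proof (elim disjE exE conjE)
      assume "odd_order_product I p"
      then show ?thesis
        using odd_order_product_disjoint_comp[OF oc _ cs(2)] by blast
    next
      fix ds T q
      assume ds: "distinct ds" "even (length ds)" "ds \<noteq> []" "set ds \<inter> T = {}" "I = set ds \<union> T"
        and q: "odd_order_product T q" and p: "p = cycle_of_list ds \<circ> q"
      have "odd_order_product (set cs \<union> T) (cycle_of_list cs \<circ> q)"
        using cs ds by (intro odd_order_product_disjoint_comp[OF oc q]) auto
      moreover have "cycle_of_list cs \<circ> p = cycle_of_list ds \<circ> (cycle_of_list cs \<circ> q)"
        using cycles_commute[of cs ds] cs ds unfolding p
        by (metis Int_Un_distrib comp_assoc sup_eq_bot_iff)
      moreover have "set ds \<inter> (set cs \<union> T) = {}" "set cs \<union> I = set ds \<union> (set cs \<union> T)"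
        using cs ds by auto
      ultimately show ?thesis using ds(1-3) by blast
    qed
  next
    case even_cs: 3
    from comp.IH show ?thesis
    proof (elim disjE exE conjE)
      assume "odd_order_product I p"
      then show ?thesis using cs even_cs by blast
    next
      fix ds T q
      assume ds: "distinct ds" "even (length ds)" "ds \<noteq> []" "set ds \<inter> T = {}" "I = set ds \<union> T"
        and q: "odd_order_product T q" and p: "p = cycle_of_list ds \<circ> q"
      have "odd_order_product (set cs \<union> set ds) (cycle_of_list cs \<circ> cycle_of_list ds)"
        using cs ds even_cs by (intro odd_order_product_two_even_cycles) auto
      then have "odd_order_product (set cs \<union> set ds \<union> T) (cycle_of_list cs \<circ> cycle_of_list ds \<circ> q)"
        using cs ds by (intro odd_order_product_disjoint_comp[OF _ q]) auto
      then show ?thesis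
        unfolding p ds(5) comp_assoc Un_assoc by (rule disjI1)
    qed
  qed
qed

lemma evenperm_cycle_iff:
  assumes "distinct cs"
  shows "evenperm (cycle_of_list cs) \<longleftrightarrow> even (length cs - 1)"
  using swapidseq_ext_imp_swapidseq[OF swapidseq_ext_of_cycles[OF assms]] evenperm_unique by blast

section \<open>Squares in the alternating group\<close>

lemma group_squares_alt_group_subset: "group_squares (alt_group n) \<subseteq> carrier (alt_group n)"
proof -
  interpret A: group "alt_group n" by (rule alt_group_is_group)
  show ?thesis unfolding group_squares_def by auto
qed

lemma odd_order_product_imp_two_squares:
  assumes "odd_order_product T q" and "T \<subseteq> {1..n}"
  obtains s t where "s \<in> group_squares (alt_group n)" "t \<in> group_squares (alt_group n)" "q = s \<circ> t"
  using assms odd_order_imp_square permutes_subset unfolding odd_order_product_def by metis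

lemma alt_group_two_squares:
  assumes "p \<in> carrier (alt_group n)"
  obtains s t where "s \<in> group_squares (alt_group n)" "t \<in> group_squares (alt_group n)" "p = s \<circ> t"
proof -
  have p: "p permutes {1..n}" "evenperm p"
    using assms by (simp_all add: alt_group_carrier)
  have "cycle_decomp {1..n} p"
    using p(1) by (intro cycle_decomposition) auto
  from cycle_decomp_odd_order_product[OF this] have "odd_order_product {1..n} p"
  proof (elim disjE exE conjE)
    fix ds T q
    assume ds: "distinct ds" "even (length ds)" "ds \<noteq> []" and T: "{1..n} = set ds \<union> T"
      and q: "odd_order_product T q" and pq: "p = cycle_of_list ds \<circ> q"
    \<comment> \<open>An unpaired even cycle would make \<open>p\<close> odd, since products of squares are even.\<close>
    have "T \<subseteq> {1..n}" using T by blast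
    then obtain s t where "s \<in> group_squares (alt_group n)" "t \<in> group_squares (alt_group n)"
      and st: "q = s \<circ> t"
      by (rule odd_order_product_imp_two_squares[OF q])
    then have "s \<in> carrier (alt_group n)" "t \<in> carrier (alt_group n)"
      using group_squares_alt_group_subset by blast+
    then have "evenperm q" "permutation q"
      unfolding st using alt_group_carrier'[of s n] alt_group_carrier'[of t n]
      by (simp_all add: permutation_compose evenperm_comp alt_group_carrier)
    then have "evenperm (cycle_of_list ds)"
      using p(2) evenperm_comp[OF permutation_of_cycle] unfolding pq by blast
    then have False
      using ds by (simp add: evenperm_cycle_iff)
    then show ?thesis ..
  qed
  then show ?thesis
    using odd_order_product_imp_two_squares that by blast
qed

lemma alt_group_not_all_squares:
  assumes "n > 3"
  shows "\<exists>g \<in> carrier (alt_group n). g \<notin> group_squares (alt_group n)"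
proof -
  interpret A: group "alt_group n" by (rule alt_group_is_group)
  let ?sq = "\<lambda>x. x [^]\<^bsub>alt_group n\<^esub> (2::nat)" and ?C = "carrier (alt_group n)"
  let ?v = "transpose 1 2 \<circ> transpose 3 (4::nat)"
  have sq: "?sq x = x \<circ> x" if "x \<in> ?C" for x
    using that by (simp add: numeral_2_eq_2 A.nat_pow_Suc alt_group_mult alt_group_one)
  have "?v permutes {1..n}"
    using assms by (intro permutes_compose permutes_swap_id) auto
  moreover have "evenperm ?v"
    by (simp add: evenperm_comp permutation_swap_id evenperm_swap)
  ultimately have v: "?v \<in> ?C" by (simp add: alt_group_carrier)
  have one: "id \<in> ?C" using A.one_closed by (simp add: alt_group_one)
  have "?v \<circ> ?v = id \<circ> id"
    by (auto simp: fun_eq_iff transpose_def)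
  then have "?sq ?v = ?sq id"
    using sq[OF v] sq[OF one] by simp
  moreover have "?v 1 = 2" by simp
  then have "?v \<noteq> id" by (metis id_apply numeral_One numeral_eq_iff semiring_norm(85))
  ultimately have "\<not> inj_on ?sq ?C"
    using v one by (metis inj_onD)
  moreover have "finite ?C"
    by (rule finite_subset[OF _ finite_permutations[of "{1..n}"]])
      (auto simp: alt_group_carrier)
  ultimately have "?sq ` ?C \<noteq> ?C"
    using finite_surj_inj[of ?C ?sq] by blast
  then show ?thesis
    unfolding group_squares_def by auto
qed

section \<open>The verbal width\<close>

theorem theorem15:
  fixes n :: nat
  assumes "n > 3"
  shows "verbal_subgroup (alt_group n) (group_squares (alt_group n)) = carrier (alt_group n)
    \<and> verbal_width (alt_group n) (group_squares (alt_group n)) = 2"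
proof -
  interpret A: group "alt_group n" by (rule alt_group_is_group)
  let ?G = "alt_group n" and ?S = "group_squares (alt_group n)"
  have gen: "verbal_subgroup ?G ?S = carrier ?G"
    unfolding verbal_subgroup_def
  proof
    show "generate ?G ?S \<subseteq> carrier ?G"
      by (rule A.generate_incl[OF group_squares_alt_group_subset])
    show "carrier ?G \<subseteq> generate ?G ?S"
    proof
      fix p assume "p \<in> carrier ?G"
      then obtain s t where "s \<in> ?S" "t \<in> ?S" "p = s \<circ> t" by (rule alt_group_two_squares)
      then show "p \<in> generate ?G ?S"
        using generate.eng[OF generate.incl generate.incl, of s ?S t ?G]
        by (simp add: alt_group_mult)
    qed
  qed
  have le: "product_of_at_most ?G ?S 2 p" if "p \<in> carrier ?G" for p
  proof -
    obtain s t where "s \<in> ?S" "t \<in> ?S" "p = s \<circ> t" using \<open>p \<in> carrier ?G\<close> by (rule alt_group_two_squares)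
    then show ?thesis
      unfolding product_of_at_most_def
      by (intro exI[of _ "[s, t]"]) (simp add: alt_group_mult alt_group_one numeral_eq_enat)
  qed
  \<comment> \<open>The identity is a square, so the empty word yields nothing beyond the words of length 1.\<close>
  have ge: "2 \<le> m" if m: "\<forall>g \<in> carrier ?G. product_of_at_most ?G ?S m g" for m
  proof (rule ccontr)
    assume "\<not> 2 \<le> m"
    obtain g where g: "g \<in> carrier ?G" "g \<notin> ?S"
      using alt_group_not_all_squares[OF assms] by blast
    then obtain xs where xs: "set xs \<subseteq> ?S" "enat (length xs) \<le> m"
      "foldr (\<otimes>\<^bsub>?G\<^esub>) xs \<one>\<^bsub>?G\<^esub> = g"
      using m unfolding product_of_at_most_def by blast
    have "enat (length xs) < enat 2"
      using xs(2) \<open>\<not> 2 \<le> m\<close> by (metis not_le numeral_eq_enat order_le_less_trans)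
    then have "length xs = 0 \<or> length xs = 1" by (auto dest: less_2_cases)
    moreover have "\<one>\<^bsub>?G\<^esub> \<in> ?S"
      unfolding group_squares_def using A.nat_pow_one A.one_closed by (metis (mono_tags) mem_Collect_eq)
    ultimately have "g \<in> ?S"
      using xs(1,3) by (auto simp: length_Suc_conv alt_group_mult alt_group_one)
    then show False using g(2) by blast
  qed
  have "verbal_width ?G ?S = 2"
    unfolding verbal_width_def gen
  proof (rule antisym)
    show "Inf {m. \<forall>g\<in>carrier ?G. product_of_at_most ?G ?S m g} \<le> 2"
      using le by (intro Inf_lower) simp
    show "2 \<le> Inf {m. \<forall>g\<in>carrier ?G. product_of_at_most ?G ?S m g}"
      using ge by (intro Inf_greatest) simp
  qed
  then show ?thesis using gen by blast
qed

end
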